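(* Let $\mathcal C=(c_{ij})_{i,j\ge0}$ be an infinite tridiagonal matrix (rows and columns indexed by nonnegative integers, $c_{ij}=0$ if $|i-j|>1$), whose nonzero entries are indeterminates (or complex numbers for which the denominators below are nonzero). Let $\mathcal Z_k=(\mathcal C^k)_{0,0}$ for $k\ge0$, let $\mathcal C\mathrm{Motz}(N,r)$ be the generating function of $\mathcal C$-weighted partial Motzkin paths from $(0,0)$ to $(N,r)$, and let $k_r=\prod_{i=0}^{r-1}c_{i,i+1}$. Then for integers $N\ge r\ge0$, $$\frac{1}{k_r}\,\mathcal C\mathrm{Motz}(N,r)=\frac{1}{k_r}(\mathcal C^N)_{0,r}=\mathcal K_{(N-r,0,\dots,0)},$$ where $(N-r,0,\dots,0)$ has exactly $r$ zeros (so $n=r+1$ entries).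
   Context: A partial Motzkin path from $(0,0)$ to $(N,r)$ is a lattice path using steps $(1,1)$, $(1,0)$, $(1,-1)$ that never goes below the $x$-axis; a step from height $i$ to height $j$ gets weight $c_{ij}$, a path gets the product of its step weights, and the generating function is the sum of weights of all such paths. For an integer sequence $\mu=(\mu_1,\dots,\mu_n)$ with $\mu_i+n-i\ge0$ for all $i$, define $$\mathcal K_{\mu}=\frac{\det\big(\mathcal Z_{\mu_i+2n-i-j}\big)_{i,j=1}^n}{\det\big(\mathcal Z_{2n-i-j}\big)_{i,j=1}^n}.$$ *)

theory Defs
  imports
    "Jordan_Normal_Form.Determinant"
    "HOL-Computational_Algebra.Fraction_Field"
    "HOL-Library.Poly_Mapping"
    "HOL-Library.Product_Plus"
    "HOL-Library.Nat_Bijection"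
begin

type_synonym 'a inf_mat = "nat \<Rightarrow> nat \<Rightarrow> 'a"

definition tridiagonal :: "'a::zero inf_mat \<Rightarrow> bool" where
  "tridiagonal C \<longleftrightarrow> (\<forall>i j. \<bar>int i - int j\<bar> > 1 \<longrightarrow> C i j = 0)"

(* Sum_any sums over the indices with nonzero summand. This set is finite whenever the left
   factor has finitely many nonzero entries per row, in particular if it is tridiagonal. *)
definition inf_mat_mult :: "'a::semiring_0 inf_mat \<Rightarrow> 'a inf_mat \<Rightarrow> 'a inf_mat" where
  "inf_mat_mult A B = (\<lambda>i j. Sum_any (\<lambda>k. A i k * B k j))"

fun inf_mat_power :: "'a::semiring_1 inf_mat \<Rightarrow> nat \<Rightarrow> 'a inf_mat" where
  "inf_mat_power C 0 = (\<lambda>i j. if i = j then 1 else 0)"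
| "inf_mat_power C (Suc k) = inf_mat_mult C (inf_mat_power C k)"

definition Z :: "'a::semiring_1 inf_mat \<Rightarrow> nat \<Rightarrow> 'a" where
  "Z C k = inf_mat_power C k 0 0"

(* A path starting at (0,0) is represented by its list of steps;
   the point reached after k steps is sum_list (take k s). *)
definition motzkin_paths :: "nat \<Rightarrow> nat \<Rightarrow> (int \<times> int) list set" where
  "motzkin_paths N r =
     {s. set s \<subseteq> {(1, 1), (1, 0), (1, -1)} \<and> sum_list s = (int N, int r) \<and>
         (\<forall>k\<le>length s. 0 \<le> snd (sum_list (take k s)))}"

definition path_weight :: "'a::comm_semiring_1 inf_mat \<Rightarrow> (int \<times> int) list \<Rightarrow> 'a" where
  "path_weight C s =
     (\<Prod>k<length s. C (nat (snd (sum_list (take k s)))) (nat (snd (sum_list (take (Suc k) s)))))"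

definition Motz :: "'a::comm_semiring_1 inf_mat \<Rightarrow> nat \<Rightarrow> nat \<Rightarrow> 'a" where
  "Motz C N r = (\<Sum>s\<in>motzkin_paths N r. path_weight C s)"

definition kprod :: "'a::comm_semiring_1 inf_mat \<Rightarrow> nat \<Rightarrow> 'a" where
  "kprod C r = (\<Prod>i<r. C i (Suc i))"

(* Library matrices and lists are indexed from 0, so the 1-based indices are i + 1 and j + 1.
   The subscripts of Z are nonnegative: in the numerator because of the condition
   \<mu>_i + n - i \<ge> 0 on the sequence, in the denominator because i, j < n. *)
definition K_numerator :: "'a::comm_ring_1 inf_mat \<Rightarrow> int list \<Rightarrow> 'a" where
  "K_numerator C \<mu> =
     (let n = length \<mu> in
      det (mat n n (\<lambda>(i, j). Z C (nat (\<mu> ! i + 2 * int n - int (i + 1) - int (j + 1))))))"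

definition K_denominator :: "'a::comm_ring_1 inf_mat \<Rightarrow> nat \<Rightarrow> 'a" where
  "K_denominator C n = det (mat n n (\<lambda>(i, j). Z C (2 * n - (i + 1) - (j + 1))))"

definition K :: "'a::field inf_mat \<Rightarrow> int list \<Rightarrow> 'a" where
  "K C \<mu> = K_numerator C \<mu> / K_denominator C (length \<mu>)"

(* Rational functions over 'b in countably many indeterminates indexed by nat: an element of
   nat \<Rightarrow>\<^sub>0 nat is a monomial, given by its exponents. *)
type_synonym 'b ratfun = "((nat \<Rightarrow>\<^sub>0 nat) \<Rightarrow>\<^sub>0 'b) fract"

definition indet :: "nat \<Rightarrow> 'b::idom ratfun" where
  "indet v = Fract (Poly_Mapping.single (Poly_Mapping.single v 1) 1) 1"

(* prod_encode is a bijection, so the entries on the three diagonals are distinct indeterminates. *)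
definition indet_tridiagonal :: "'b::idom ratfun inf_mat" where
  "indet_tridiagonal i j =
     (if \<bar>int i - int j\<bar> \<le> 1 then indet (prod_encode (i, j)) else 0)"

end

theory Submission
  imports Defs
begin

text \<open>Since \<open>Z (a + b) = (\<Sum>k. (C^a)\<^bsub>0,k\<^esub> (C^b)\<^bsub>k,0\<^esub>)\<close>, the matrices in the numerator
  and in the denominator factor as \<open>A\<^sub>N B\<close> and \<open>A\<^sub>r B\<close>, where \<open>A\<^sub>N\<close> has the rows
  \<open>(C^N)\<^bsub>0,k\<^esub>\<close>, \<open>(C^(r-1))\<^bsub>0,k\<^esub>\<close>, \dots, \<open>(C^0)\<^bsub>0,k\<^esub>\<close> for \<open>k \<le> r\<close>. The only nonzero entry
  in the last column of \<open>A\<^sub>N\<close> is \<open>(C^N)\<^bsub>0,r\<^esub>\<close> in the first row, with a cofactor that does not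
  depend on \<open>N\<close>, and \<open>(C^r)\<^bsub>0,r\<^esub> = k\<^sub>r\<close>. In the generic case \<open>A\<^sub>r\<close> and \<open>B\<close> are
  triangular up to the order of the rows, with nonzero diagonal.\<close>

subsection \<open>Powers of tridiagonal matrices\<close>

lemma tridiagonal_zero: "tridiagonal C \<Longrightarrow> Suc i < j \<or> Suc j < i \<Longrightarrow> C i j = 0"
  unfolding tridiagonal_def by auto

lemma inf_mat_mult_tridiagonal:
  assumes "tridiagonal C"
  shows "inf_mat_mult C B i j = (\<Sum>k\<le>Suc i. C i k * B k j)"
  unfolding inf_mat_mult_def
proof (rule Sum_any.expand_superset)
  show "{k. C i k * B k j \<noteq> 0} \<subseteq> {..Suc i}"
    using tridiagonal_zero[OF assms, of i] by (auto, metis mult_zero_left not_le)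
qed simp

lemma inf_mat_power_add:
  assumes "tridiagonal C" and "i + a \<le> m"
  shows "inf_mat_power C (a + b) i j = (\<Sum>k\<le>m. inf_mat_power C a i k * inf_mat_power C b k j)"
  using assms(2)
proof (induction a arbitrary: i)
  case 0
  have "(\<Sum>k\<le>m. inf_mat_power C 0 i k * inf_mat_power C b k j)
      = (\<Sum>k\<le>m. if i = k then inf_mat_power C b k j else 0)"
    by (intro sum.cong) auto
  then show ?case using 0 by simp
next
  case (Suc a)
  have "inf_mat_power C (Suc a + b) i j = (\<Sum>l\<le>Suc i. C i l * inf_mat_power C (a + b) l j)"
    by (simp add: inf_mat_mult_tridiagonal[OF assms(1)])
  also have "\<dots> = (\<Sum>l\<le>Suc i. C i l * (\<Sum>k\<le>m. inf_mat_power C a l k * inf_mat_power C b k j))"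
    using Suc by (intro sum.cong) auto
  also have "\<dots> = (\<Sum>k\<le>m. (\<Sum>l\<le>Suc i. C i l * inf_mat_power C a l k) * inf_mat_power C b k j)"
    unfolding sum_distrib_left sum_distrib_right by (subst sum.swap) (simp add: mult.assoc)
  finally show ?case
    by (simp add: inf_mat_mult_tridiagonal[OF assms(1)])
qed

lemma inf_mat_power_1: "tridiagonal C \<Longrightarrow> inf_mat_power C (Suc 0) i j = C i j"
proof -
  assume C: "tridiagonal C"
  have "inf_mat_power C (Suc 0) i j = (\<Sum>k\<le>Suc i. if k = j then C i k else 0)"
    unfolding inf_mat_power.simps inf_mat_mult_tridiagonal[OF C] by (intro sum.cong) auto
  also have "\<dots> = C i j" using tridiagonal_zero[OF C, of i j] by auto
  finally show ?thesis .
qed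

lemma inf_mat_power_eq_0:
  assumes "tridiagonal C" and "i + n < j \<or> j + n < i"
  shows "inf_mat_power C n i j = 0"
  using assms(2)
proof (induction n arbitrary: i)
  case (Suc n)
  have "C i k * inf_mat_power C n k j = 0" if "k \<le> Suc i" for k
    using Suc.IH[of k] Suc.prems that tridiagonal_zero[OF assms(1), of i k]
    by (cases "Suc k < i") auto
  then show ?case by (simp add: inf_mat_mult_tridiagonal[OF assms(1)] del: sum.atMost_Suc)
qed auto

lemma inf_mat_power_Suc_right:
  assumes "tridiagonal C" and "finite S" and "{k. k \<le> Suc j \<and> j \<le> Suc k} \<subseteq> S"
  shows "inf_mat_power C (Suc n) i j = (\<Sum>k\<in>S. inf_mat_power C n i k * C k j)"
proof -
  define S' where "S' = {k. k \<le> Suc j \<and> j \<le> Suc k}"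
  define m where "m = i + n + Suc j"
  have zero: "inf_mat_power C n i k * C k j = 0" if "k \<notin> S'" for k
    using that by (auto simp: S'_def not_le tridiagonal_zero[OF assms(1)])
  have "inf_mat_power C (n + Suc 0) i j = (\<Sum>k\<le>m. inf_mat_power C n i k * C k j)"
    using inf_mat_power_add[OF assms(1), of i n m "Suc 0" j]
    unfolding inf_mat_power_1[OF assms(1)] by (simp add: m_def)
  also have "\<dots> = (\<Sum>k\<in>S'. inf_mat_power C n i k * C k j)"
    by (intro sum.mono_neutral_right ballI zero) (auto simp: S'_def m_def)
  also have "\<dots> = (\<Sum>k\<in>S. inf_mat_power C n i k * C k j)"
    using assms by (intro sum.mono_neutral_left ballI zero) (auto simp: S'_def)
  finally show ?thesis by simp
qed

lemma inf_mat_power_0_diag: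
  assumes "tridiagonal C"
  shows "inf_mat_power C n 0 n = kprod C n"
proof (induction n)
  case (Suc n)
  have "inf_mat_power C (Suc n) 0 (Suc n)
      = (\<Sum>k\<in>{n, Suc n, Suc (Suc n)}. inf_mat_power C n 0 k * C k (Suc n))"
    by (intro inf_mat_power_Suc_right assms) auto
  then show ?case
    using Suc by (simp add: kprod_def inf_mat_power_eq_0[OF assms])
qed (simp add: kprod_def)

lemma inf_mat_power_diag_0:
  assumes "tridiagonal C"
  shows "inf_mat_power C n n 0 = (\<Prod>i<n. C (Suc i) i)"
proof (induction n)
  case (Suc n)
  have "inf_mat_power C (Suc n) (Suc n) 0 = (\<Sum>k\<le>Suc (Suc n). C (Suc n) k * inf_mat_power C n k 0)"
    by (simp add: inf_mat_mult_tridiagonal[OF assms] del: sum.atMost_Suc)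
  also have "\<dots> = (\<Sum>k\<in>{n}. C (Suc n) k * inf_mat_power C n k 0)"
  proof (intro sum.mono_neutral_right ballI)
    fix k assume "k \<in> {..Suc (Suc n)} - {n}"
    then show "C (Suc n) k * inf_mat_power C n k 0 = 0"
      using tridiagonal_zero[OF assms, of "Suc n" k] inf_mat_power_eq_0[OF assms, of k n 0]
      by (cases "k < n") auto
  qed auto
  finally show ?case using Suc by (simp add: mult.commute)
qed simp

lemma Z_add:
  assumes "tridiagonal C" and "b \<le> r"
  shows "Z C (a + b) = (\<Sum>k<Suc r. inf_mat_power C a 0 k * inf_mat_power C b k 0)"
proof -
  have "Z C (a + b) = (\<Sum>k\<le>a + r. inf_mat_power C a 0 k * inf_mat_power C b k 0)"
    unfolding Z_def by (rule inf_mat_power_add[OF assms(1)]) simp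
  also have "\<dots> = (\<Sum>k<Suc r. inf_mat_power C a 0 k * inf_mat_power C b k 0)"
    using assms(2) by (intro sum.mono_neutral_right) (auto simp: inf_mat_power_eq_0[OF assms(1)])
  finally show ?thesis .
qed

subsection \<open>Motzkin paths\<close>

lemma sum_list_steps:
  "set s \<subseteq> {(1, 1), (1, 0), (1, -1)} \<Longrightarrow> fst (sum_list s) = int (length s)"
  for s :: "(int \<times> int) list"
  by (induction s) auto

lemma motzkin_paths_length: "s \<in> motzkin_paths N r \<Longrightarrow> length s = N"
  using sum_list_steps[of s] by (simp add: motzkin_paths_def)

lemma finite_motzkin_paths: "finite (motzkin_paths N r)"
proof (rule finite_subset)
  show "motzkin_paths N r \<subseteq> {s. set s \<subseteq> {(1, 1), (1, 0), (1, -1)} \<and> length s = N}"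
    using motzkin_paths_length by (auto simp: motzkin_paths_def)
qed (simp add: finite_lists_length_eq)

lemma motzkin_paths_0: "motzkin_paths 0 r = (if r = 0 then {[]} else {})"
proof -
  have "s \<in> motzkin_paths 0 r \<longleftrightarrow> s = [] \<and> r = 0" for s
    using motzkin_paths_length[of s 0 r] by (auto simp: motzkin_paths_def zero_prod_def)
  then show ?thesis by auto
qed

lemma motzkin_paths_Suc:
  "motzkin_paths (Suc N) r =
    (\<lambda>(k, s). s @ [(1, int r - int k)]) ` (SIGMA k:{k. k \<le> Suc r \<and> r \<le> Suc k}. motzkin_paths N k)"
  (is "?L = ?f ` ?R")
proof (intro equalityI subsetI)
  fix t assume t: "t \<in> ?L"
  then obtain s x where tsx: "t = s @ [x]"
    using motzkin_paths_length[OF t] by (cases t rule: rev_cases) auto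
  have pre: "0 \<le> snd (sum_list (take k s))" if "k \<le> length s" for k
    using t that unfolding motzkin_paths_def tsx by (auto dest: spec[of _ k])
  define k where "k = nat (snd (sum_list s))"
  have k: "snd (sum_list s) = int k"
    using pre[of "length s"] by (simp add: k_def)
  have x: "x \<in> {(1, 1), (1, 0), (1, -1)}" "sum_list s + x = (int (Suc N), int r)"
    "set s \<subseteq> {(1, 1), (1, 0), (1, -1)}"
    using t by (auto simp: motzkin_paths_def tsx)
  have "sum_list s = (int N, int k)" "x = (1, int r - int k)" "k \<le> Suc r \<and> r \<le> Suc k"
    using x k by (cases "sum_list s"; auto)+
  then show "t \<in> ?f ` ?R"
    using pre x tsx by (intro image_eqI[of _ _ "(k, s)"]) (auto simp: motzkin_paths_def)
next
  fix t assume "t \<in> ?f ` ?R"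
  then obtain k s where ks: "t = s @ [(1, int r - int k)]" "k \<le> Suc r" "r \<le> Suc k"
    "s \<in> motzkin_paths N k" by auto
  have "int r - int k \<in> {1, 0, -1}" using ks by auto
  moreover have "0 \<le> snd (sum_list (take l t))" if "l \<le> length t" for l
    using ks that by (cases "l \<le> length s") (auto simp: motzkin_paths_def not_le)
  ultimately show "t \<in> ?L"
    using ks by (auto simp: motzkin_paths_def)
qed

lemma path_weight_snoc:
  "path_weight C (s @ [x]) =
    path_weight C s * C (nat (snd (sum_list s))) (nat (snd (sum_list s + x)))"
  by (simp add: path_weight_def)

lemma Motz_eq_inf_mat_power:
  assumes "tridiagonal C"
  shows "Motz C N r = inf_mat_power C N 0 r"
proof (induction N arbitrary: r)
  case 0
  show ?case by (simp add: Motz_def motzkin_paths_0 path_weight_def)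
next
  case (Suc N)
  define S where "S = {k. k \<le> Suc r \<and> r \<le> Suc k}"
  have fin: "finite S" by (simp add: S_def)
  have weight: "path_weight C (s @ [(1, int r - int k)]) = path_weight C s * C k r"
    if "s \<in> motzkin_paths N k" for s k
    using that by (simp add: path_weight_snoc motzkin_paths_def)
  have inj: "inj_on (\<lambda>(k, s). s @ [(1, int r - int k)]) (Sigma S (motzkin_paths N))"
    by (auto simp: inj_on_def)
  have "Motz C (Suc N) r
      = (\<Sum>(k, s)\<in>Sigma S (motzkin_paths N). path_weight C (s @ [(1, int r - int k)]))"
    unfolding Motz_def motzkin_paths_Suc S_def[symmetric] sum.reindex[OF inj]
    by (simp add: case_prod_unfold)
  also have "\<dots> = (\<Sum>k\<in>S. \<Sum>s\<in>motzkin_paths N k. path_weight C (s @ [(1, int r - int k)]))"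
    using fin by (intro sum.Sigma[symmetric]) (auto simp: finite_motzkin_paths)
  also have "\<dots> = (\<Sum>k\<in>S. Motz C N k * C k r)"
    by (simp add: weight Motz_def sum_distrib_right)
  also have "\<dots> = inf_mat_power C (Suc N) 0 r"
    unfolding Suc by (intro inf_mat_power_Suc_right[symmetric] assms fin) (simp add: S_def)
  finally show ?case .
qed

subsection \<open>The determinants\<close>

lemma det_last_column_single:
  assumes "A \<in> carrier_mat (Suc r) (Suc r)" and "\<And>i. 0 < i \<Longrightarrow> i \<le> r \<Longrightarrow> A $$ (i, r) = 0"
  shows "det A = A $$ (0, r) * cofactor A 0 r"
proof -
  have "det A = (\<Sum>i<Suc r. A $$ (i, r) * cofactor A i r)"
    using laplace_expansion_column[OF assms(1), of r] by simp
  also have "\<dots> = (\<Sum>i\<in>{0}. A $$ (i, r) * cofactor A i r)"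
    using assms(2) by (intro sum.mono_neutral_right) auto
  finally show ?thesis by simp
qed

lemma det_anti_triangular_neq_0:
  fixes f :: "nat \<Rightarrow> nat \<Rightarrow> 'a::idom"
  assumes "\<And>i j. i < j \<Longrightarrow> f i j = 0" and "\<And>i. f i i \<noteq> 0"
  shows "det (mat (Suc r) (Suc r) (\<lambda>(i, j). f (r - i) j)) \<noteq> 0"
proof (induction r)
  case 0
  show ?case using assms(2)[of 0] by (simp add: det_single)
next
  case (Suc r)
  let ?A = "mat (Suc (Suc r)) (Suc (Suc r)) (\<lambda>(i, j). f (Suc r - i) j)"
  have "mat_delete ?A 0 (Suc r) = mat (Suc r) (Suc r) (\<lambda>(i, j). f (r - i) j)"
    by (auto simp: mat_delete_def)
  then have "cofactor ?A 0 (Suc r) \<noteq> 0"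
    using Suc by (simp add: cofactor_def)
  moreover have "det ?A = ?A $$ (0, Suc r) * cofactor ?A 0 (Suc r)"
    using assms(1) by (intro det_last_column_single) auto
  ultimately show ?case using assms(2)[of "Suc r"] by simp
qed

definition left_factor :: "'a::semiring_1 inf_mat \<Rightarrow> nat \<Rightarrow> nat \<Rightarrow> 'a mat" where
  "left_factor C N r =
    mat (Suc r) (Suc r) (\<lambda>(i, k). inf_mat_power C (if i = 0 then N else r - i) 0 k)"

definition right_factor :: "'a::semiring_1 inf_mat \<Rightarrow> nat \<Rightarrow> 'a mat" where
  "right_factor C r = mat (Suc r) (Suc r) (\<lambda>(k, j). inf_mat_power C (r - j) k 0)"

lemma factor_carrier [simp]:
  "left_factor C N r \<in> carrier_mat (Suc r) (Suc r)"
  "right_factor C r \<in> carrier_mat (Suc r) (Suc r)"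
  by (simp_all add: left_factor_def right_factor_def)

lemma left_factor_mult_right_factor:
  assumes "tridiagonal C"
  shows "left_factor C N r * right_factor C r =
    mat (Suc r) (Suc r) (\<lambda>(i, j). Z C ((if i = 0 then N else r - i) + (r - j)))"
  by (rule eq_matI)
    (auto simp: left_factor_def right_factor_def scalar_prod_def Z_add[OF assms, of _ r]
      lessThan_atLeast0 simp del: sum.op_ivl_Suc intro!: sum.cong)

lemma K_numerator_eq:
  assumes "tridiagonal C" and "r \<le> N"
  shows "K_numerator C (int (N - r) # replicate r 0)
    = det (left_factor C N r) * det (right_factor C r)"
proof -
  have "K_numerator C (int (N - r) # replicate r 0)
      = det (mat (Suc r) (Suc r) (\<lambda>(i, j). Z C ((if i = 0 then N else r - i) + (r - j))))"
    unfolding K_numerator_def Let_def using assms(2)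
    by (auto simp: nth_Cons' intro!: arg_cong[where f = det] arg_cong[where f = "Z C"] eq_matI)
  then show ?thesis
    by (simp add: left_factor_mult_right_factor[OF assms(1), symmetric]
        det_mult[OF factor_carrier])
qed

lemma K_denominator_eq:
  assumes "tridiagonal C"
  shows "K_denominator C (Suc r) = det (left_factor C r r) * det (right_factor C r)"
proof -
  have "K_denominator C (Suc r)
      = det (mat (Suc r) (Suc r) (\<lambda>(i, j). Z C ((if i = 0 then r else r - i) + (r - j))))"
    unfolding K_denominator_def
    by (auto intro!: arg_cong[where f = det] arg_cong[where f = "Z C"] eq_matI)
  then show ?thesis
    by (simp add: left_factor_mult_right_factor[OF assms, symmetric] det_mult[OF factor_carrier])
qed

lemma det_left_factor:
  assumes "tridiagonal C"
  shows "det (left_factor C N r) = inf_mat_power C N 0 r * cofactor (left_factor C r r) 0 r"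
proof -
  have "mat_delete (left_factor C N r) 0 r = mat_delete (left_factor C r r) 0 r"
    by (rule eq_matI) (auto simp: mat_delete_def left_factor_def)
  moreover have "det (left_factor C N r)
      = left_factor C N r $$ (0, r) * cofactor (left_factor C N r) 0 r"
    by (intro det_last_column_single) (auto simp: left_factor_def inf_mat_power_eq_0[OF assms])
  ultimately show ?thesis
    by (simp add: cofactor_def left_factor_def)
qed

lemma kprod_mult_K_numerator:
  assumes "tridiagonal C" and "r \<le> N"
  shows "kprod C r * K_numerator C (int (N - r) # replicate r 0)
    = inf_mat_power C N 0 r * K_denominator C (Suc r)"
  unfolding K_numerator_eq[OF assms] K_denominator_eq[OF assms(1)] det_left_factor[OF assms(1)]
    inf_mat_power_0_diag[OF assms(1)]
  by (simp add: ac_simps)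

lemma K_denominator_neq_0:
  fixes C :: "'a::idom inf_mat"
  assumes "tridiagonal C" and "\<And>i. C i (Suc i) \<noteq> 0" and "\<And>i. C (Suc i) i \<noteq> 0"
  shows "K_denominator C (Suc r) \<noteq> 0"
proof -
  have "left_factor C r r = mat (Suc r) (Suc r) (\<lambda>(i, k). inf_mat_power C (r - i) 0 k)"
    by (rule eq_matI) (auto simp: left_factor_def)
  then have "det (left_factor C r r) \<noteq> 0"
    using assms det_anti_triangular_neq_0[of "\<lambda>n k. inf_mat_power C n 0 k" r]
    by (simp add: inf_mat_power_eq_0 inf_mat_power_0_diag kprod_def)
  moreover have "transpose_mat (right_factor C r)
      = mat (Suc r) (Suc r) (\<lambda>(j, k). inf_mat_power C (r - j) k 0)"
    by (rule eq_matI) (auto simp: right_factor_def)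
  then have "det (transpose_mat (right_factor C r)) \<noteq> 0"
    using assms det_anti_triangular_neq_0[of "\<lambda>n k. inf_mat_power C n k 0" r]
    by (simp add: inf_mat_power_eq_0 inf_mat_power_diag_0)
  ultimately show ?thesis
    by (simp add: K_denominator_eq[OF assms(1)] det_transpose[OF factor_carrier(2)])
qed

lemma Motz_eq_K:
  fixes C :: "'a::field inf_mat"
  assumes "tridiagonal C" and "r \<le> N" and "kprod C r \<noteq> 0" and "K_denominator C (r + 1) \<noteq> 0"
  shows "1 / kprod C r * Motz C N r = 1 / kprod C r * inf_mat_power C N 0 r \<and>
    1 / kprod C r * inf_mat_power C N 0 r = K C (int (N - r) # replicate r 0)"
  using kprod_mult_K_numerator[OF assms(1,2)] assms(3,4)
  by (simp add: Motz_eq_inf_mat_power[OF assms(1)] K_def field_simps)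

lemma indet_neq_0: "indet v \<noteq> (0 :: 'b::idom ratfun)"
proof -
  have "Poly_Mapping.single (Poly_Mapping.single v 1) (1 :: 'b) \<noteq> 0"
    by (metis lookup_single_eq lookup_zero zero_neq_one)
  then show ?thesis
    by (simp add: indet_def Zero_fract_def eq_fract del: One_nat_def)
qed

theorem theorem4p6:
  fixes C :: "'a::field inf_mat"
    and X :: "'b::field ratfun inf_mat"
    and N r :: nat
  assumes "r \<le> N"
    and "X = indet_tridiagonal"
  shows "(tridiagonal C \<and> kprod C r \<noteq> 0 \<and> K_denominator C (r + 1) \<noteq> 0 \<longrightarrow>
            1 / kprod C r * Motz C N r = 1 / kprod C r * inf_mat_power C N 0 r \<and>
            1 / kprod C r * inf_mat_power C N 0 r = K C (int (N - r) # replicate r 0)) \<and>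
         (kprod X r \<noteq> 0 \<and> K_denominator X (r + 1) \<noteq> 0 \<and>
            1 / kprod X r * Motz X N r = 1 / kprod X r * inf_mat_power X N 0 r \<and>
            1 / kprod X r * inf_mat_power X N 0 r = K X (int (N - r) # replicate r 0))"
proof -
  have X: "tridiagonal X" "\<And>i. X i (Suc i) \<noteq> 0" "\<And>i. X (Suc i) i \<noteq> 0"
    by (auto simp: assms(2) tridiagonal_def indet_tridiagonal_def indet_neq_0)
  have "kprod X r \<noteq> 0" "K_denominator X (r + 1) \<noteq> 0"
    using X(2) K_denominator_neq_0[OF X, of r] by (simp_all add: kprod_def)
  then show ?thesis
    using Motz_eq_K[of C, OF _ assms(1)] Motz_eq_K[OF X(1) assms(1)] by simp
qed

end
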